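(* Let $n\ge 1$ and let $A\in M_n(\mathbb{H})$. Then $w_{\mathbb{H}}(A)\le\|A\|\le 2\,w_{\mathbb{H}}(A)$.
   Context: $\mathbb{H}$ denotes the real quaternions and $M_n(\mathbb{H})$ the $n\times n$ quaternionic matrices, acting on column vectors in the right quaternionic Hilbert space $\mathbb{H}^n$ from the left. The inner product is $\langle (p_l),(q_l)\rangle_{\mathbb{H}}=\sum_l\overline{p_l}\,q_l$, with norm $\|X\|=\langle X,X\rangle_{\mathbb{H}}^{1/2}$; $S_{\mathbb{H}^n}$ is the unit sphere. $\|A\|=\sup\{\|AX\|:X\in S_{\mathbb{H}^n}\}$ is the operator norm. The quaternionic numerical range is $W_{\mathbb{H}}(A)=\{\langle X,AX\rangle_{\mathbb{H}}:X\in S_{\mathbb{H}^n}\}$ and the quaternionic numerical radius is $w_{\mathbb{H}}(A)=\sup\{|q|:q\in W_{\mathbb{H}}(A)\}$. *)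

theory Defs
  imports "HOL-Analysis.Analysis"
begin

section \<open>The real quaternions\<close>

text \<open>\<open>Quat a b c d\<close> is the quaternion \<open>a + b i + c j + d k\<close>.\<close>

datatype quat = Quat (qRe: real) (qIm1: real) (qIm2: real) (qIm3: real)

lemma quat_eq_iff:
  "p = q \<longleftrightarrow> qRe p = qRe q \<and> qIm1 p = qIm1 q \<and> qIm2 p = qIm2 q \<and> qIm3 p = qIm3 q"
  by (auto intro: quat.expand)

definition qcnj :: "quat \<Rightarrow> quat" where
  "qcnj q = Quat (qRe q) (- qIm1 q) (- qIm2 q) (- qIm3 q)"

instantiation quat :: ring_1
begin

definition zero_quat :: quat where "0 = Quat 0 0 0 0"

definition one_quat :: quat where "1 = Quat 1 0 0 0"

definition uminus_quat :: "quat \<Rightarrow> quat" where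
  "- q = Quat (- qRe q) (- qIm1 q) (- qIm2 q) (- qIm3 q)"

definition plus_quat :: "quat \<Rightarrow> quat \<Rightarrow> quat" where
  "p + q = Quat (qRe p + qRe q) (qIm1 p + qIm1 q) (qIm2 p + qIm2 q) (qIm3 p + qIm3 q)"

definition minus_quat :: "quat \<Rightarrow> quat \<Rightarrow> quat" where
  "p - q = Quat (qRe p - qRe q) (qIm1 p - qIm1 q) (qIm2 p - qIm2 q) (qIm3 p - qIm3 q)"

text \<open>The product is the bilinear one with \<open>i\<^sup>2 = j\<^sup>2 = k\<^sup>2 = i j k = - 1\<close>.\<close>

definition times_quat :: "quat \<Rightarrow> quat \<Rightarrow> quat" where
  "p * q = Quat
     (qRe p * qRe q - qIm1 p * qIm1 q - qIm2 p * qIm2 q - qIm3 p * qIm3 q)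
     (qRe p * qIm1 q + qIm1 p * qRe q + qIm2 p * qIm3 q - qIm3 p * qIm2 q)
     (qRe p * qIm2 q - qIm1 p * qIm3 q + qIm2 p * qRe q + qIm3 p * qIm1 q)
     (qRe p * qIm3 q + qIm1 p * qIm2 q - qIm2 p * qIm1 q + qIm3 p * qRe q)"

instance
  by standard
    (simp_all add: zero_quat_def one_quat_def uminus_quat_def plus_quat_def minus_quat_def
      times_quat_def algebra_simps)

end

lemma quat_sel_simps [simp]:
  "qRe 0 = 0" "qIm1 0 = 0" "qIm2 0 = 0" "qIm3 0 = 0"
  "qRe 1 = 1" "qIm1 1 = 0" "qIm2 1 = 0" "qIm3 1 = 0"
  "qRe (- p) = - qRe p" "qIm1 (- p) = - qIm1 p" "qIm2 (- p) = - qIm2 p" "qIm3 (- p) = - qIm3 p"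
  "qRe (p + q) = qRe p + qRe q" "qIm1 (p + q) = qIm1 p + qIm1 q"
  "qIm2 (p + q) = qIm2 p + qIm2 q" "qIm3 (p + q) = qIm3 p + qIm3 q"
  "qRe (p - q) = qRe p - qRe q" "qIm1 (p - q) = qIm1 p - qIm1 q"
  "qIm2 (p - q) = qIm2 p - qIm2 q" "qIm3 (p - q) = qIm3 p - qIm3 q"
  "qRe (qcnj p) = qRe p" "qIm1 (qcnj p) = - qIm1 p"
  "qIm2 (qcnj p) = - qIm2 p" "qIm3 (qcnj p) = - qIm3 p"
  by (simp_all add: zero_quat_def one_quat_def uminus_quat_def plus_quat_def minus_quat_def
      qcnj_def)

lemma quat_sel_times:
  "qRe (p * q) = qRe p * qRe q - qIm1 p * qIm1 q - qIm2 p * qIm2 q - qIm3 p * qIm3 q"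
  "qIm1 (p * q) = qRe p * qIm1 q + qIm1 p * qRe q + qIm2 p * qIm3 q - qIm3 p * qIm2 q"
  "qIm2 (p * q) = qRe p * qIm2 q - qIm1 p * qIm3 q + qIm2 p * qRe q + qIm3 p * qIm1 q"
  "qIm3 (p * q) = qRe p * qIm3 q + qIm1 p * qIm2 q - qIm2 p * qIm1 q + qIm3 p * qRe q"
  by (simp_all add: times_quat_def)

instantiation quat :: real_normed_div_algebra
begin

definition scaleR_quat :: "real \<Rightarrow> quat \<Rightarrow> quat" where
  "r *\<^sub>R q = Quat (r * qRe q) (r * qIm1 q) (r * qIm2 q) (r * qIm3 q)"

definition norm_quat :: "quat \<Rightarrow> real" where
  "norm q = sqrt ((qRe q)\<^sup>2 + (qIm1 q)\<^sup>2 + (qIm2 q)\<^sup>2 + (qIm3 q)\<^sup>2)"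

definition inverse_quat :: "quat \<Rightarrow> quat" where
  "inverse q = (1 / (norm q)\<^sup>2) *\<^sub>R qcnj q"

definition divide_quat :: "quat \<Rightarrow> quat \<Rightarrow> quat" where
  "p div q = p * inverse q" for p q :: quat

definition sgn_quat :: "quat \<Rightarrow> quat" where
  "sgn q = inverse (norm q) *\<^sub>R q" for q :: quat

definition dist_quat :: "quat \<Rightarrow> quat \<Rightarrow> real" where
  "dist p q = norm (p - q)" for p q :: quat

definition uniformity_quat :: "(quat \<times> quat) filter" where
  "uniformity_quat = (INF e\<in>{0<..}. principal {(x, y). dist x y < e})"

definition open_quat :: "quat set \<Rightarrow> bool" where
  "open_quat U \<longleftrightarrow> (\<forall>x\<in>U. eventually (\<lambda>(x', y). x' = x \<longrightarrow> y \<in> U) uniformity)" for U :: "quat set"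

instance
proof
  fix p q :: quat and r s :: real
  have sel: "qRe (r *\<^sub>R q) = r * qRe q" "qIm1 (r *\<^sub>R q) = r * qIm1 q"
    "qIm2 (r *\<^sub>R q) = r * qIm2 q" "qIm3 (r *\<^sub>R q) = r * qIm3 q" for r q
    by (simp_all add: scaleR_quat_def)
  have norm_sq: "(norm q)\<^sup>2 = (qRe q)\<^sup>2 + (qIm1 q)\<^sup>2 + (qIm2 q)\<^sup>2 + (qIm3 q)\<^sup>2" for q :: quat
    by (simp add: norm_quat_def)
  have norm_tuple: "norm q = norm ((qRe q, qIm1 q), (qIm2 q, qIm3 q))" for q :: quat
    by (simp add: norm_quat_def norm_Pair)
  show norm0: "norm q = 0 \<longleftrightarrow> q = 0" for q :: quat
    by (simp add: norm_tuple quat_eq_iff prod_eq_iff conj_assoc)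
  show "r *\<^sub>R (p + q) = r *\<^sub>R p + r *\<^sub>R q" "(r + s) *\<^sub>R q = r *\<^sub>R q + s *\<^sub>R q"
    "r *\<^sub>R s *\<^sub>R q = (r * s) *\<^sub>R q" "1 *\<^sub>R q = q"
    "r *\<^sub>R p * q = r *\<^sub>R (p * q)" "p * r *\<^sub>R q = r *\<^sub>R (p * q)"
    by (simp_all add: quat_eq_iff sel quat_sel_times algebra_simps)
  have mult_cnj: "q * qcnj q = (norm q)\<^sup>2 *\<^sub>R 1" "qcnj q * q = (norm q)\<^sup>2 *\<^sub>R 1" for q
    unfolding norm_sq by (simp_all add: quat_eq_iff sel quat_sel_times power2_eq_square)
  have scale: "p * r *\<^sub>R q = r *\<^sub>R (p * q)" "r *\<^sub>R p * q = r *\<^sub>R (p * q)"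
    "r *\<^sub>R s *\<^sub>R q = (r * s) *\<^sub>R q" "1 *\<^sub>R q = q" for r s and p q :: quat
    by (simp_all add: quat_eq_iff sel quat_sel_times algebra_simps)
  show "inverse q * q = 1" "q * inverse q = 1" if "q \<noteq> 0"
    using that norm0[of q] by (simp_all add: inverse_quat_def scale mult_cnj)
  show "p div q = p * inverse q"
    by (simp add: divide_quat_def)
  show "inverse (0 :: quat) = 0"
    by (simp add: inverse_quat_def quat_eq_iff sel)
  show "sgn q = inverse (norm q) *\<^sub>R q" "dist p q = norm (p - q)" for p q :: quat
    by (simp_all add: sgn_quat_def dist_quat_def)
  show "(uniformity :: (quat \<times> quat) filter) = (INF e\<in>{0<..}. principal {(x, y). dist x y < e})"
    by (simp add: uniformity_quat_def)
  show "open U \<longleftrightarrow> (\<forall>x\<in>U. \<forall>\<^sub>F (x', y) in uniformity. x' = x \<longrightarrow> y \<in> U)" for U :: "quat set"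
    by (simp add: open_quat_def)
  show "norm (p + q) \<le> norm p + norm q"
    using norm_triangle_ineq[of "((qRe p, qIm1 p), (qIm2 p, qIm3 p))"
        "((qRe q, qIm1 q), (qIm2 q, qIm3 q))"]
    by (simp add: norm_tuple)
  show "norm (r *\<^sub>R q) = \<bar>r\<bar> * norm q"
    using norm_scaleR[of r "((qRe q, qIm1 q), (qIm2 q, qIm3 q))"]
    by (simp add: norm_tuple sel)
  show "norm (p * q) = norm p * norm q"
  proof (rule power2_eq_imp_eq)
    show "(norm (p * q))\<^sup>2 = (norm p * norm q)\<^sup>2"
      unfolding power_mult_distrib norm_sq quat_sel_times by algebra
  qed (simp_all add: norm_quat_def)
qed

end

section \<open>Quaternionic column vectors and matrices\<close>

text \<open>
  \<open>A *v X\<close> has entries \<open>\<Sum>j. A $ i $ j * X $ j\<close>, so matrices act from the left and the action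
  is right linear.
\<close>

definition qinner :: "quat ^ 'n \<Rightarrow> quat ^ 'n \<Rightarrow> quat" where
  "qinner X Y = (\<Sum>l\<in>UNIV. qcnj (X $ l) * Y $ l)"

text \<open>\<open>qinner X X\<close> is a nonnegative real quaternion (see \<open>qinner_self\<close> below); its square root is
  taken through its real part.\<close>

definition qnorm :: "quat ^ 'n \<Rightarrow> real" where
  "qnorm X = sqrt (qRe (qinner X X))"

definition qsphere :: "(quat ^ 'n) set" where
  "qsphere = {X. qnorm X = 1}"

definition qopnorm :: "quat ^ 'n ^ 'n \<Rightarrow> real" where
  "qopnorm A = Sup {qnorm (A *v X) | X. X \<in> qsphere}"

definition qnumerical_range :: "quat ^ 'n ^ 'n \<Rightarrow> quat set" where
  "qnumerical_range A = {qinner X (A *v X) | X. X \<in> qsphere}"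

definition qnumerical_radius :: "quat ^ 'n ^ 'n \<Rightarrow> real" where
  "qnumerical_radius A = Sup {norm q | q. q \<in> qnumerical_range A}"

lemma qcnj_mult_self: "qcnj q * q = of_real ((norm q)\<^sup>2)"
  by (simp add: of_real_def quat_eq_iff quat_sel_times scaleR_quat_def norm_quat_def
      power2_eq_square)

lemma qinner_self: "qinner X X = of_real ((norm X)\<^sup>2)"
  by (simp add: qinner_def qcnj_mult_self norm_vec_def L2_set_def sum_nonneg)

lemma qnorm_eq_norm: "qnorm X = norm X"
  by (simp add: qnorm_def qinner_self of_real_def scaleR_quat_def del: of_real_power)

text \<open>Both suprema are over nonempty sets that are bounded above, as \<open>Sup\<close> on \<open>real\<close> is
  unspecified otherwise.\<close>

lemma qsphere_nonempty: "(qsphere :: (quat ^ 'n) set) \<noteq> {}"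
proof -
  have "axis undefined 1 \<in> (qsphere :: (quat ^ 'n) set)"
    by (simp add: qsphere_def qnorm_eq_norm norm_vec_def L2_set_def axis_def
        if_distrib[where f = norm] if_distrib[where f = "\<lambda>x. x\<^sup>2"] cong: if_cong)
  then show ?thesis by blast
qed

lemma norm_qinner_le: "norm (qinner X Y) \<le> norm X * norm Y"
proof -
  have cnj: "norm (qcnj q) = norm q" for q
    by (simp add: norm_quat_def)
  have "norm (qinner X Y) \<le> (\<Sum>l\<in>UNIV. norm (X $ l) * norm (Y $ l))"
    unfolding qinner_def
    by (rule order_trans[OF norm_sum]) (simp add: norm_mult cnj)
  also have "\<dots> \<le> norm X * norm Y"
    using L2_set_mult_ineq[of "\<lambda>l. norm (X $ l)" "\<lambda>l. norm (Y $ l)" UNIV]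
    by (simp add: norm_vec_def)
  finally show ?thesis .
qed

lemma norm_matrix_vector_mult_le:
  fixes A :: "quat ^ 'n ^ 'n"
  assumes "X \<in> qsphere"
  shows "norm (A *v X) \<le> (\<Sum>i\<in>UNIV. \<Sum>j\<in>UNIV. norm (A $ i $ j))"
proof -
  have "norm (X $ j) \<le> 1" for j
    using Finite_Cartesian_Product.norm_nth_le[of X j] assms
    by (simp add: qsphere_def qnorm_eq_norm)
  then have "norm ((A *v X) $ i) \<le> (\<Sum>j\<in>UNIV. norm (A $ i $ j))" for i
    unfolding matrix_vector_mult_def
    by (simp, intro sum_norm_le) (simp add: norm_mult mult_left_le)
  moreover have "norm (A *v X) \<le> (\<Sum>i\<in>UNIV. norm ((A *v X) $ i))"
    unfolding norm_vec_def by (rule L2_set_le_sum) simp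
  ultimately show ?thesis
    by (meson order_trans sum_mono)
qed

lemma bdd_above_qopnorm:
  fixes A :: "quat ^ 'n ^ 'n"
  shows "bdd_above {qnorm (A *v X) | X. X \<in> qsphere}"
  using norm_matrix_vector_mult_le[of _ A] by (auto simp: qnorm_eq_norm intro!: bdd_aboveI)

lemma bdd_above_qnumerical_radius:
  fixes A :: "quat ^ 'n ^ 'n"
  shows "bdd_above {norm q | q. q \<in> qnumerical_range A}"
proof (rule bdd_aboveI)
  fix r assume "r \<in> {norm q | q. q \<in> qnumerical_range A}"
  then obtain X where X: "X \<in> qsphere" "r = norm (qinner X (A *v X))"
    by (auto simp: qnumerical_range_def)
  then have "r \<le> norm (A *v X)"
    using norm_qinner_le[of X "A *v X"] by (simp add: qsphere_def qnorm_eq_norm)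
  then show "r \<le> (\<Sum>i\<in>UNIV. \<Sum>j\<in>UNIV. norm (A $ i $ j))"
    using norm_matrix_vector_mult_le[OF X(1), of A] by simp
qed

end

theory Submission
  imports Defs
begin

text \<open>
  Put \<open>w = w(A)\<close>. For unit vectors \<open>X\<close>, \<open>Y\<close> and a unit quaternion \<open>q\<close>, polarization gives
  \<open>f(X + Yq) - f(X - Yq) = 2 (a q + q\<^sup>* b)\<close>, where \<open>f(Z) = \<langle>Z, AZ\<rangle>\<close>, \<open>a = \<langle>X, AY\<rangle>\<close> and
  \<open>b = \<langle>Y, AX\<rangle>\<close>; by the parallelogram law its norm is at most \<open>4 w\<close>. Its real part is
  \<open>2 Re ((a + b\<^sup>*) q)\<close> and its imaginary part is \<open>2 Im ((a - b\<^sup>*) q)\<close>. Rotating \<open>a + b\<^sup>*\<close> to a real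
  quaternion and \<open>a - b\<^sup>*\<close> to a multiple of \<open>i\<close> by a suitable choice of \<open>q\<close> bounds both by \<open>2 w\<close>, so
  \<open>|a| \<le> 2 w\<close>.
\<close>

lemma qcnj_add: "qcnj (p + q) = qcnj p + qcnj q"
  by (simp add: quat_eq_iff)

lemma qcnj_diff: "qcnj (p - q) = qcnj p - qcnj q"
  by (simp add: quat_eq_iff)

lemma qcnj_mult: "qcnj (p * q) = qcnj q * qcnj p"
  by (simp add: quat_eq_iff quat_sel_times algebra_simps)

lemma norm_qcnj: "norm (qcnj q) = norm q"
  by (simp add: norm_quat_def)

lemma abs_qRe_le_norm: "\<bar>qRe q\<bar> \<le> norm q"
  unfolding norm_quat_def by (rule real_le_rsqrt) simp

lemma abs_qIm1_le_norm: "\<bar>qIm1 q\<bar> \<le> norm q"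
  unfolding norm_quat_def by (rule real_le_rsqrt) simp

lemma qinner_add_left: "qinner (X + Y) Z = qinner X Z + qinner Y Z"
  by (simp add: qinner_def qcnj_add distrib_right sum.distrib)

lemma qinner_add_right: "qinner X (Y + Z) = qinner X Y + qinner X Z"
  by (simp add: qinner_def distrib_left sum.distrib)

lemma qinner_diff_left: "qinner (X - Y) Z = qinner X Z - qinner Y Z"
  by (simp add: qinner_def qcnj_diff left_diff_distrib sum_subtractf)

lemma qinner_diff_right: "qinner X (Y - Z) = qinner X Y - qinner X Z"
  by (simp add: qinner_def right_diff_distrib sum_subtractf)

lemmas qinner_linear = qinner_add_left qinner_add_right qinner_diff_left qinner_diff_right

text \<open>Scalars act on the right, so that they commute with the left action of matrices.\<close>

definition qscale :: "quat ^ 'n \<Rightarrow> quat \<Rightarrow> quat ^ 'n" where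
  "qscale X q = (\<chi> i. X $ i * q)"

lemma qinner_qscale: "qinner (qscale X p) (qscale Y q) = qcnj p * qinner X Y * q"
  by (simp add: qinner_def qscale_def qcnj_mult sum_distrib_left sum_distrib_right mult.assoc)

lemma qscale_1 [simp]: "qscale X 1 = X"
  by (simp add: qscale_def)

lemma qinner_qscale_left: "qinner (qscale X p) Y = qcnj p * qinner X Y"
  using qinner_qscale[of X p Y 1] by simp

lemma qinner_qscale_right: "qinner X (qscale Y q) = qinner X Y * q"
  by (simp add: qinner_def qscale_def sum_distrib_right mult.assoc)

lemma norm_qscale: "norm (qscale X q) = norm X * norm q"
  by (simp add: norm_vec_def qscale_def norm_mult L2_set_left_distrib)

lemma matrix_vector_mult_qscale:
  fixes A :: "quat ^ 'n ^ 'm"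
  shows "A *v qscale X q = qscale (A *v X) q"
  by (simp add: vec_eq_iff matrix_vector_mult_def qscale_def sum_distrib_right mult.assoc)

text \<open>The cross terms cancel in the quaternion-valued form of the identity;
  \<open>qinner_self\<close> and injectivity of \<open>of_real\<close> carry it over to real
  norms.\<close>

lemma parallelogram_quat:
  fixes X Y :: "quat ^ 'n"
  shows "(norm (X + Y))\<^sup>2 + (norm (X - Y))\<^sup>2 = 2 * (norm X)\<^sup>2 + 2 * (norm Y)\<^sup>2"
proof -
  have "qinner (X + Y) (X + Y) + qinner (X - Y) (X - Y) = 2 * qinner X X + 2 * qinner Y Y"
    by (simp add: qinner_linear mult_2 algebra_simps)
  then have "(of_real ((norm (X + Y))\<^sup>2 + (norm (X - Y))\<^sup>2) :: quat)
      = of_real (2 * (norm X)\<^sup>2 + 2 * (norm Y)\<^sup>2)"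
    by (simp add: qinner_self)
  then show ?thesis
    unfolding of_real_eq_iff .
qed

lemma norm_qinner_le_qnumerical_radius:
  fixes A :: "quat ^ 'n ^ 'n"
  assumes "norm X = 1"
  shows "norm (qinner X (A *v X)) \<le> qnumerical_radius A"
  unfolding qnumerical_radius_def
  by (rule cSup_upper[OF _ bdd_above_qnumerical_radius])
    (use assms in \<open>auto simp: qnumerical_range_def qsphere_def qnorm_eq_norm\<close>)

text \<open>By homogeneity: scaling \<open>Z\<close> by \<open>r\<close> multiplies the norm of the
  form by \<open>(norm r)\<^sup>2\<close>, which reduces the claim to unit vectors.\<close>

lemma norm_quadratic_form_le:
  fixes A :: "quat ^ 'n ^ 'n"
  shows "norm (qinner Z (A *v Z)) \<le> qnumerical_radius A * (norm Z)\<^sup>2"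
proof (cases "Z = 0")
  case True
  then show ?thesis by (simp add: qinner_def)
next
  case False
  define r where "r = (of_real (1 / norm Z) :: quat)"
  have nr: "norm r = 1 / norm Z"
    unfolding r_def norm_of_real by simp
  have "norm (qscale Z r) = 1"
    using False by (simp add: norm_qscale nr)
  then have "norm (qinner (qscale Z r) (A *v qscale Z r)) \<le> qnumerical_radius A"
    by (rule norm_qinner_le_qnumerical_radius)
  then show ?thesis
    using False
    by (simp add: matrix_vector_mult_qscale qinner_qscale norm_mult norm_qcnj nr field_simps
        power2_eq_square)
qed

lemma norm_polarization_le:
  fixes A :: "quat ^ 'n ^ 'n"
  assumes "norm X = 1" "norm Y = 1" "norm q = 1"
  shows "norm (qinner X (A *v Y) * q + qcnj q * qinner Y (A *v X)) \<le> 2 * qnumerical_radius A"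
proof -
  let ?Z = "qscale Y q" and ?w = "qnumerical_radius A"
  let ?D = "qinner X (A *v Y) * q + qcnj q * qinner Y (A *v X)"
  \<comment> \<open>The diagonal terms cancel and each cross term occurs twice.\<close>
  have "2 * ?D = qinner (X + ?Z) (A *v (X + ?Z)) - qinner (X - ?Z) (A *v (X - ?Z))"
    by (simp add: matrix_vector_right_distrib matrix_vector_mult_diff_distrib
        matrix_vector_mult_qscale qinner_linear qinner_qscale_left qinner_qscale_right mult_2
        algebra_simps)
  then have "2 * norm ?D = norm (qinner (X + ?Z) (A *v (X + ?Z)) - qinner (X - ?Z) (A *v (X - ?Z)))"
    by (metis norm_mult norm_numeral)
  also have "\<dots> \<le> norm (qinner (X + ?Z) (A *v (X + ?Z))) + norm (qinner (X - ?Z) (A *v (X - ?Z)))"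
    by (rule norm_triangle_ineq4)
  also have "\<dots> \<le> ?w * (norm (X + ?Z))\<^sup>2 + ?w * (norm (X - ?Z))\<^sup>2"
    by (intro add_mono norm_quadratic_form_le)
  \<comment> \<open>Both \<open>X\<close> and \<open>?Z\<close> are unit vectors, so the
    parallelogram law gives 2 + 2.\<close>
  also have "\<dots> = ?w * 4"
    using assms by (simp add: parallelogram_quat norm_qscale flip: distrib_left)
  finally show ?thesis by simp
qed

text \<open>For nonzero \<open>s\<close>, solving for \<open>q\<close> gives
  \<open>norm s *\<^sub>R (inverse s * u)\<close>, a unit because the norm is
  multiplicative.\<close>

lemma exists_unit_rotation:
  fixes s u :: quat
  assumes "norm u = 1"
  obtains q where "norm q = 1" "s * q = norm s *\<^sub>R u"
proof (cases "s = 0")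
  case True
  with assms that[of 1] show ?thesis by simp
next
  case False
  show ?thesis
  proof (rule that[of "norm s *\<^sub>R (inverse s * u)"])
    show "norm (norm s *\<^sub>R (inverse s * u)) = 1"
      using False assms by (simp add: norm_mult norm_inverse)
    show "s * norm s *\<^sub>R (inverse s * u) = norm s *\<^sub>R u"
      using False by (simp flip: mult.assoc)
  qed
qed

lemma norm_qinner_matrix_le:
  fixes A :: "quat ^ 'n ^ 'n"
  assumes X: "norm X = 1" and Y: "norm Y = 1"
  shows "norm (qinner X (A *v Y)) \<le> 2 * qnumerical_radius A"
proof -
  define a b where "a = qinner X (A *v Y)" and "b = qinner Y (A *v X)"
  let ?w = "qnumerical_radius A" and ?i = "Quat 0 1 0 0"
  have D: "norm (a * q + qcnj q * b) \<le> 2 * ?w" if "norm q = 1" for q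
    unfolding a_def b_def using X Y that by (rule norm_polarization_le)
  obtain q where q: "norm q = 1" "(a + qcnj b) * q = norm (a + qcnj b) *\<^sub>R 1"
    by (rule exists_unit_rotation[of 1]) simp_all
  \<comment> \<open>Conjugation fixes real parts and turns \<open>qcnj q * b\<close> into
    \<open>qcnj b * q\<close>.\<close>
  have "qRe (a * q + qcnj q * b) = qRe ((a + qcnj b) * q)"
    by (simp add: quat_sel_times algebra_simps)
  also have "\<dots> = norm (a + qcnj b)"
    by (simp add: q scaleR_quat_def)
  finally have plus: "norm (a + qcnj b) \<le> 2 * ?w"
    using abs_qRe_le_norm[of "a * q + qcnj q * b"] D[OF q(1)] by simp
  have "norm ?i = 1"
    by (simp add: norm_quat_def)
  then obtain p where p: "norm p = 1" "(a - qcnj b) * p = norm (a - qcnj b) *\<^sub>R ?i"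
    by (rule exists_unit_rotation)
  \<comment> \<open>Here conjugation flips the sign, whence \<open>a - qcnj b\<close>; the choice of
    \<open>p\<close> puts its whole norm into the \<open>i\<close> coordinate.\<close>
  have "qIm1 (a * p + qcnj p * b) = qIm1 ((a - qcnj b) * p)"
    by (simp add: quat_sel_times algebra_simps)
  also have "\<dots> = norm (a - qcnj b)"
    by (simp add: p scaleR_quat_def)
  finally have minus: "norm (a - qcnj b) \<le> 2 * ?w"
    using abs_qIm1_le_norm[of "a * p + qcnj p * b"] D[OF p(1)] by simp
  have "2 * norm a = norm ((a + qcnj b) + (a - qcnj b))"
    by (simp add: norm_mult flip: mult_2)
  also have "\<dots> \<le> norm (a + qcnj b) + norm (a - qcnj b)"
    by (rule norm_triangle_ineq)
  finally show ?thesis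
    using plus minus by (simp add: a_def)
qed

text \<open>Duality: pairing \<open>A *v Y\<close> with its own normalization recovers its
  norm.\<close>

lemma norm_matrix_vector_le_qnumerical_radius:
  fixes A :: "quat ^ 'n ^ 'n"
  assumes "norm Y = 1"
  shows "norm (A *v Y) \<le> 2 * qnumerical_radius A"
proof (cases "A *v Y = 0")
  case True
  \<comment> \<open>What remains is that the radius is nonnegative; the bound with both vectors
    equal to \<open>Y\<close> gives this, its left side being 0.\<close>
  then show ?thesis
    using norm_qinner_matrix_le[OF assms assms, of A] by (simp add: qinner_def)
next
  case False
  define r where "r = (of_real (1 / norm (A *v Y)) :: quat)"
  have nr: "norm r = 1 / norm (A *v Y)"
    unfolding r_def norm_of_real by simp
  have "norm (qscale (A *v Y) r) = 1"
    using False by (simp add: norm_qscale nr)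
  then have "norm (qinner (qscale (A *v Y) r) (A *v Y)) \<le> 2 * qnumerical_radius A"
    using assms by (rule norm_qinner_matrix_le)
  then show ?thesis
    using False
    by (simp add: qinner_qscale_left norm_mult norm_qcnj nr qinner_self power2_eq_square)
qed

theorem theorem3p3:
  fixes A :: "quat ^ 'n ^ 'n"
  shows "qnumerical_radius A \<le> qopnorm A \<and> qopnorm A \<le> 2 * qnumerical_radius A"
proof
  show "qnumerical_radius A \<le> qopnorm A"
    unfolding qnumerical_radius_def
  proof (rule cSup_least)
    show "{norm q | q. q \<in> qnumerical_range A} \<noteq> {}"
      using qsphere_nonempty by (auto simp: qnumerical_range_def)
  next
    fix r assume "r \<in> {norm q | q. q \<in> qnumerical_range A}"
    then obtain X where X: "X \<in> qsphere" "r = norm (qinner X (A *v X))"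
      by (auto simp: qnumerical_range_def)
    \<comment> \<open>Cauchy-Schwarz with a unit vector \<open>X\<close>.\<close>
    then have "r \<le> qnorm (A *v X)"
      using norm_qinner_le[of X "A *v X"] by (simp add: qsphere_def qnorm_eq_norm)
    also have "\<dots> \<le> qopnorm A"
      unfolding qopnorm_def using X(1) by (intro cSup_upper bdd_above_qopnorm) auto
    finally show "r \<le> qopnorm A" .
  qed
  show "qopnorm A \<le> 2 * qnumerical_radius A"
    unfolding qopnorm_def
    by (rule cSup_least)
      (use qsphere_nonempty norm_matrix_vector_le_qnumerical_radius in
        \<open>auto simp: qsphere_def qnorm_eq_norm\<close>)
qed

end
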